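(* Let $n\ge 2$, let $\mathcal{X}\subset\mathbb{R}^n$ be a convex body and $f:\mathcal{X}\to[-B,B]$ a continuous convex function. Let $R\ge r>0$ be such that $\mathcal{X}$ is contained in the Euclidean ball of radius $R$ centered at $c_0$ and $\mathcal{X}$ contains a Euclidean ball of radius $r$. Run the ellipsoid method (defined in the context) from $c_0$ and $H_0=R^2 I_n$, producing centers $c_0,c_1,c_2,\dots$. Then for every integer $t\ge 2n^2\log(R/r)$ one has $\{c_0,\dots,c_t\}\cap\mathcal{X}\ne\emptyset$, and for $x_t\in\mathrm{argmin}_{c\in\{c_0,\dots,c_t\}\cap\mathcal{X}}f(c)$, $$f(x_t)-\min_{x\in\mathcal{X}}f(x)\le\frac{2BR}{r}\exp\left(-\frac{t}{2n^2}\right).$$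
   Context: A convex body is a compact convex set with non-empty interior. $\partial f(x)$ is the set of $g\in\mathbb{R}^n$ with $f(x)-f(y)\le g^\top(x-y)$ for all $y\in\mathcal{X}$. Ellipsoid method: for $t\ge 0$, given $c_t\in\mathbb{R}^n$ and a positive definite matrix $H_t$: (1) If $c_t\notin\mathcal{X}$, a separation oracle returns a vector $w_t\neq 0$ with $\mathcal{X}\subset\{x:(x-c_t)^\top w_t\le 0\}$. If $c_t\in\mathcal{X}$, a first order oracle returns some $w_t\in\partial f(c_t)$. (2) If $w_t\ne0$, set $$c_{t+1}=c_t-\frac{1}{n+1}\frac{H_tw_t}{\sqrt{w_t^\top H_tw_t}},\qquad H_{t+1}=\frac{n^2}{n^2-1}\left(H_t-\frac{2}{n+1}\frac{H_tw_tw_t^\top H_t}{w_t^\top H_tw_t}\right).$$ If $w_t=0$ (in which case $c_t\in\mathcal{X}$ minimizes $f$ on $\mathcal{X}$), set $c_{t+1}=c_t$, $H_{t+1}=H_t$. The current ellipsoid is $\mathcal{E}_t=\{x:(x-c_t)^\top H_t^{-1}(x-c_t)\le 1\}$. *)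

theory Defs
  imports "HOL-Analysis.Analysis"
begin

definition convex_body :: "(real ^ 'n) set \<Rightarrow> bool" where
  "convex_body X \<longleftrightarrow> compact X \<and> convex X \<and> interior X \<noteq> {}"

text \<open>
  Only the values of \<open>f\<close> on \<open>X\<close> matter when \<open>x \<in> X\<close>. The set may be empty at boundary
  points of \<open>X\<close>.
\<close>

definition subdifferential :: "(real ^ 'n) set \<Rightarrow> (real ^ 'n \<Rightarrow> real) \<Rightarrow> real ^ 'n \<Rightarrow> (real ^ 'n) set"
  where "subdifferential X f x = {g. \<forall>y\<in>X. f x - f y \<le> g \<bullet> (x - y)}"

definition outer_product :: "real ^ 'n \<Rightarrow> real ^ 'n ^ 'n" where
  "outer_product w = columnvector w ** (rowvector w :: real ^ 'n ^ 1)"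

text \<open>
  The relation \<open>oracle_answer X f c w\<close> says that \<open>w\<close> is an admissible answer to the query \<open>c\<close>:
  from the separation oracle if \<open>c \<notin> X\<close>, from the first order oracle if \<open>c \<in> X\<close>. As a relation
  it covers all such oracles, including those whose answer depends on the history of the run.
\<close>

definition oracle_answer ::
    "(real ^ 'n) set \<Rightarrow> (real ^ 'n \<Rightarrow> real) \<Rightarrow> real ^ 'n \<Rightarrow> real ^ 'n \<Rightarrow> bool" where
  "oracle_answer X f c w \<longleftrightarrow>
     (if c \<notin> X then w \<noteq> 0 \<and> X \<subseteq> {x. (x - c) \<bullet> w \<le> 0} else w \<in> subdifferential X f c)"

definition next_center :: "real ^ 'n ^ 'n \<Rightarrow> real ^ 'n \<Rightarrow> real ^ 'n \<Rightarrow> real ^ 'n" where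
  "next_center H w c =
     (if w = 0 then c
      else c - (1 / (real CARD('n) + 1)) *\<^sub>R ((1 / sqrt (w \<bullet> (H *v w))) *\<^sub>R (H *v w)))"

definition next_matrix :: "real ^ 'n ^ 'n \<Rightarrow> real ^ 'n \<Rightarrow> real ^ 'n ^ 'n" where
  "next_matrix H w =
     (if w = 0 then H
      else ((real CARD('n))\<^sup>2 / ((real CARD('n))\<^sup>2 - 1)) *\<^sub>R
        (H - (2 / (real CARD('n) + 1)) *\<^sub>R
               ((1 / (w \<bullet> (H *v w))) *\<^sub>R (H ** outer_product w ** H))))"

text \<open>
  A run of the ellipsoid method from \<open>c0\<close> and \<open>H0\<close>: \<open>c t\<close>, \<open>H t\<close> and \<open>w t\<close> are the center,
  the matrix and the oracle answer in step \<open>t\<close>.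
\<close>

definition ellipsoid_run ::
    "(real ^ 'n) set \<Rightarrow> (real ^ 'n \<Rightarrow> real) \<Rightarrow> real ^ 'n \<Rightarrow> real ^ 'n ^ 'n \<Rightarrow>
     (nat \<Rightarrow> real ^ 'n) \<Rightarrow> (nat \<Rightarrow> real ^ 'n ^ 'n) \<Rightarrow> (nat \<Rightarrow> real ^ 'n) \<Rightarrow> bool" where
  "ellipsoid_run X f c0 H0 c H w \<longleftrightarrow>
     c 0 = c0 \<and> H 0 = H0 \<and>
     (\<forall>t. oracle_answer X f (c t) (w t) \<and>
          c (Suc t) = next_center (H t) (w t) (c t) \<and>
          H (Suc t) = next_matrix (H t) (w t))"

end

theory Submission
  imports Defs
begin

text \<open>
  Each oracle answer \<open>w\<close> at a center \<open>c\<close> splits the current ellipsoid in half. A point \<open>x\<close> in the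
  half with \<open>(x - c) \<bullet> w > 0\<close> that lies in \<open>X\<close> can only be lost if \<open>c\<close> lies in \<open>X\<close> too, since a separating
  hyperplane keeps all of \<open>X\<close>; then \<open>w\<close> is a subgradient, and its inequality gives \<open>f c \<le> f x\<close>. The
  other half is covered by the next ellipsoid, whose volume is smaller by at least the factor
  \<open>exp (- 1 / (2 * n))\<close>.

  Let \<open>x'\<close> minimize \<open>f\<close> on \<open>X\<close>, let the ball of radius \<open>r\<close> around \<open>z\<close> be contained in \<open>X\<close>, and put
  \<open>\<epsilon> = R / r * exp (- t / (2 * n\<^sup>2))\<close>, which is at most 1 for the given range of \<open>t\<close>. Shrinking this
  ball towards \<open>x'\<close> by the factor \<open>\<epsilon>\<close> gives a ball of radius \<open>\<epsilon> * r\<close> in \<open>X\<close> on which, by convexity,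
  \<open>f\<close> exceeds its minimum by at most \<open>2 * B * \<epsilon>\<close>. The ellipsoid after the \<open>t + 1\<close> queries
  \<open>c 0, \<dots>, c t\<close> is too small to contain the shrunken ball, so one of its points has been
  cut off, and the center responsible for that is as good as this point
  (\<open>exists_good_center\<close>). If some answer is zero, its center is already a minimizer.

  The proof uses no measure theory. The ellipsoid is carried as an affine image of the unit
  ball under a factor \<open>A\<close> with \<open>H = A ** transpose A\<close>, and \<open>\<bar>det A\<bar>\<close> plays the role of the
  volume. Up to a rotation, one step composes \<open>A\<close> with a fixed diagonal matrix
  (\<open>ellipsoid_step\<close>), and an ellipsoid that contains a ball of radius \<open>\<rho>\<close> satisfies
  \<open>\<rho> ^ n \<le> \<bar>det A\<bar>\<close> (\<open>ball_in_ellipsoid_imp_det_ge\<close>), because the determinant of a contraction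
  has absolute value at most 1.
\<close>

section \<open>Ellipsoids and determinants\<close>

text \<open>
  For \<open>H = A ** transpose A\<close> with \<open>A\<close> nonsingular this is the set of all \<open>x\<close> with
  \<open>(x - c) \<bullet> (matrix_inv H *v (x - c)) \<le> 1\<close>. It depends on \<open>H\<close> only, so any factor \<open>A\<close> of \<open>H\<close> may be
  chosen, and neither the inverse nor the square root of \<open>H\<close> is ever formed.
\<close>

definition ellipsoid :: "real ^ 'n \<Rightarrow> real ^ 'n ^ 'n \<Rightarrow> (real ^ 'n) set" where
  "ellipsoid c A = (\<lambda>u. c + A *v u) ` cball 0 1"

lemma abs_det_le_fact:
  fixes A :: "real ^ 'n ^ 'n"
  assumes "\<And>i j. \<bar>A $ i $ j\<bar> \<le> 1"
  shows "\<bar>det A\<bar> \<le> fact CARD('n)"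
proof -
  let ?P = "{p. p permutes (UNIV :: 'n set)}"
  have "\<bar>det A\<bar> \<le> (\<Sum>p\<in>?P. \<bar>of_int (sign p) * (\<Prod>i\<in>UNIV. A $ i $ p i)\<bar>)"
    unfolding det_def by (rule sum_abs)
  also have "\<dots> \<le> (\<Sum>p\<in>?P. 1)"
  proof (rule sum_mono)
    fix p :: "'n \<Rightarrow> 'n"
    have "\<bar>\<Prod>i\<in>UNIV. A $ i $ p i\<bar> \<le> 1"
      using assms by (auto simp: abs_prod intro!: prod_le_1)
    then show "\<bar>of_int (sign p) * (\<Prod>i\<in>UNIV. A $ i $ p i)\<bar> \<le> 1"
      by (simp add: abs_mult sign_def)
  qed
  also have "\<dots> = fact CARD('n)"
    by (simp add: card_permutations)
  finally show ?thesis .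
qed

text \<open>
  All powers of a contraction are contractions, so their entries are bounded by 1, and their
  determinants by the number of terms in the Leibniz formula. If \<open>\<bar>det M\<bar>\<close> exceeded 1, then the
  powers of \<open>det M\<close> would be unbounded.
\<close>

lemma abs_det_contraction_le_1:
  fixes M :: "real ^ 'n ^ 'n"
  assumes "\<And>x. norm (M *v x) \<le> norm x"
  shows "\<bar>det M\<bar> \<le> 1"
proof (rule ccontr)
  assume "\<not> \<bar>det M\<bar> \<le> 1"
  then obtain k where k: "fact CARD('n) < \<bar>det M\<bar> ^ k"
    using real_arch_pow[of "\<bar>det M\<bar>"] by auto
  define P where "P = ((\<lambda>N. M ** N) ^^ k) (mat 1)"
  have "(\<forall>x. norm (((\<lambda>N. M ** N) ^^ j) (mat 1) *v x) \<le> norm x)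
      \<and> det (((\<lambda>N. M ** N) ^^ j) (mat 1)) = det M ^ j" for j
    by (induction j)
      (auto simp: det_mul simp flip: matrix_vector_mul_assoc intro: order_trans[OF assms])
  then have P: "\<And>x. norm (P *v x) \<le> norm x" "det P = det M ^ k"
    by (auto simp: P_def)
  have "\<bar>P $ i $ j\<bar> \<le> 1" for i j
  proof -
    have "P $ i $ j = (P *v axis j 1) $ i"
      by (simp add: matrix_vector_mult_basis column_def)
    also have "\<bar>\<dots>\<bar> \<le> norm (P *v axis j 1)"
      by (rule component_le_norm_cart)
    also have "\<dots> \<le> 1"
      using P(1)[of "axis j 1"] by simp
    finally show ?thesis .
  qed
  then have "\<bar>det P\<bar> \<le> fact CARD('n)"
    by (rule abs_det_le_fact)
  with P(2) k show False
    by (simp add: power_abs)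
qed

lemma det_scaleR:
  fixes M :: "real ^ 'n ^ 'n"
  shows "det (a *\<^sub>R M) = a ^ CARD('n) * det M"
  using det_rows_mul[of "\<lambda>i. a" "\<lambda>i. M $ i"]
  by (simp add: scalar_mult_eq_scaleR scaleR_vec_def)

text \<open>
  This replaces the comparison of the volumes of the two sets. The inverse of \<open>A\<close> maps the ball
  into a translate of the unit ball; taking half the difference of the images of two antipodal
  points removes the translation, so \<open>\<rho>\<close> times the inverse is a contraction.
\<close>

lemma ball_in_ellipsoid_imp_det_ge:
  fixes A :: "real ^ 'n ^ 'n"
  assumes sub: "cball z \<rho> \<subseteq> ellipsoid c A" and "\<rho> \<ge> 0" and A: "det A \<noteq> 0"
  shows "\<rho> ^ CARD('n) \<le> \<bar>det A\<bar>"
proof -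
  obtain A' where A': "A' ** A = mat 1" "A ** A' = mat 1"
    using A by (auto simp: invertible_def simp flip: invertible_det_nz)
  define M where "M = \<rho> *\<^sub>R A'"
  have unit: "norm (M *v x) \<le> 1" if x: "norm x = 1" for x
  proof -
    have "z + \<rho> *\<^sub>R x \<in> cball z \<rho>" "z - \<rho> *\<^sub>R x \<in> cball z \<rho>"
      using x \<open>\<rho> \<ge> 0\<close> by (auto simp: dist_norm)
    with sub have "z + \<rho> *\<^sub>R x \<in> ellipsoid c A" "z - \<rho> *\<^sub>R x \<in> ellipsoid c A"
      by auto
    then obtain u v where uv: "norm u \<le> 1" "norm v \<le> 1"
      and u: "z + \<rho> *\<^sub>R x = c + A *v u" and v: "z - \<rho> *\<^sub>R x = c + A *v v"
      by (auto simp: ellipsoid_def)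
    have "2 *\<^sub>R (\<rho> *\<^sub>R x) = (z + \<rho> *\<^sub>R x) - (z - \<rho> *\<^sub>R x)"
      unfolding scaleR_2 by simp
    also have "\<dots> = A *v (u - v)"
      unfolding u v by (simp add: matrix_vector_mult_diff_distrib)
    finally have "A' *v (2 *\<^sub>R (\<rho> *\<^sub>R x)) = u - v"
      by (simp add: matrix_vector_mul_assoc A')
    then have "2 *\<^sub>R (M *v x) = u - v"
      by (simp add: M_def matrix_vector_mult_scaleR flip: scaleR_matrix_vector_assoc)
    then have "2 * norm (M *v x) = norm (u - v)"
      by (metis norm_scaleR abs_numeral)
    with norm_triangle_ineq4[of u v] uv show ?thesis
      by linarith
  qed
  have "norm (M *v x) \<le> norm x" for x
  proof (cases "x = 0")
    case False
    have "M *v x = norm x *\<^sub>R (M *v (x /\<^sub>R norm x))"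
      using False by (simp add: matrix_vector_mult_scaleR)
    then have "norm (M *v x) = norm x * norm (M *v (x /\<^sub>R norm x))"
      by (metis norm_scaleR abs_norm_cancel)
    also have "\<dots> \<le> norm x * 1"
      using False by (intro mult_left_mono unit) auto
    finally show ?thesis by simp
  qed simp
  then have "\<bar>det M\<bar> \<le> 1"
    by (rule abs_det_contraction_le_1)
  moreover have "det M * det A = \<rho> ^ CARD('n)"
    using arg_cong[OF A'(1), of det] by (simp add: M_def det_scaleR det_mul)
  ultimately show ?thesis
    using \<open>\<rho> \<ge> 0\<close> mult_right_mono[of "\<bar>det M\<bar>" 1 "\<bar>det A\<bar>"] by (simp flip: abs_mult)
qed

text \<open>
  The left-hand side is the volume ratio of consecutive ellipsoids. The rate \<open>1 / (2 * n)\<close> leaves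
  little room: the bounds \<open>1 / (n + 1) \<le> ln (1 + 1 / n)\<close> and \<open>ln x \<le> x - 1\<close> give only
  \<open>1 / (2 * (n + 1))\<close>. The trapezoidal bound from above and the midpoint bound from below for the
  integral of \<open>1 / x\<close> are just sharp enough: they give
  \<open>1 / (2 * n) + 1 / (4 * n\<^sup>2 * (n + 1) * (2 * n + 1))\<close>.
\<close>

lemma shrink_factor_le:
  fixes m :: nat
  assumes "m \<ge> 2"
  defines "n \<equiv> real m"
  shows "(n / (n + 1)) * (n / sqrt (n\<^sup>2 - 1)) ^ (m - 1) \<le> exp (- 1 / (2 * n))"
proof -
  have n: "n \<ge> 2"
    using assms by simp
  then have n2: "n\<^sup>2 > 1"
    by (smt (verit) one_less_power pos2)
  have upper: "ln (n\<^sup>2 / (n\<^sup>2 - 1)) \<le> (2 * n\<^sup>2 - 1) / (2 * n\<^sup>2 * (n\<^sup>2 - 1))"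
  proof -
    have "ln (n\<^sup>2 / (n\<^sup>2 - 1)) = ln ((n\<^sup>2 - 1) + 1) - ln (n\<^sup>2 - 1)"
      using n2 n by (simp add: ln_div)
    also have "\<dots> \<le> 1 * (inverse (n\<^sup>2 - 1) + inverse ((n\<^sup>2 - 1) + 1)) / 2"
      using n2 by (intro ln_inverse_approx_le) auto
    also have "\<dots> = (2 * n\<^sup>2 - 1) / (2 * n\<^sup>2 * (n\<^sup>2 - 1))"
    proof -
      have "1 * (inverse q + inverse (q + 1)) / 2 = (2 * (q + 1) - 1) / (2 * (q + 1) * q)"
        if "q > 0" for q :: real
        using that by (simp add: divide_simps) (simp add: algebra_simps)
      from this[of "n\<^sup>2 - 1"] n2 show ?thesis
        by (simp only: diff_add_cancel diff_gt_0_iff_gt)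
    qed
    finally show ?thesis .
  qed
  have lower: "ln (n / (n + 1)) \<le> - (2 / (2 * n + 1))"
    using ln_inverse_approx_ge[of n "n + 1"] n by (simp add: ln_div)
  have pos: "n / sqrt (n\<^sup>2 - 1) > 0" "n / (n + 1) > 0"
    using n n2 by auto
  have "ln (n / sqrt (n\<^sup>2 - 1)) = ln (sqrt (n\<^sup>2 / (n\<^sup>2 - 1)))"
    using n by (simp add: real_sqrt_divide)
  also have "\<dots> = ln (n\<^sup>2 / (n\<^sup>2 - 1)) / 2"
    using n2 by (intro ln_sqrt) simp
  finally have "ln (n / (n + 1) * (n / sqrt (n\<^sup>2 - 1)) ^ (m - 1))
      = ln (n / (n + 1)) + (n - 1) * (ln (n\<^sup>2 / (n\<^sup>2 - 1)) / 2)"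
    using pos assms by (subst ln_mult_pos) (auto simp: ln_realpow of_nat_diff)
  also have "\<dots> \<le> - (2 / (2 * n + 1)) + (n - 1) * ((2 * n\<^sup>2 - 1) / (2 * n\<^sup>2 * (n\<^sup>2 - 1)) / 2)"
    using lower upper n by (intro add_mono mult_left_mono divide_right_mono) auto
  also have "\<dots> = - 1 / (2 * n) - 1 / (4 * n\<^sup>2 * (n + 1) * (2 * n + 1))"
  proof -
    have fac: "n\<^sup>2 - 1 = (n - 1) * (n + 1)"
      by (simp add: power2_eq_square algebra_simps)
    have eq: "(n - 1) * ((2 * n\<^sup>2 - 1) / (2 * n\<^sup>2 * (n\<^sup>2 - 1)) / 2) = (2 * n\<^sup>2 - 1) / (4 * n\<^sup>2 * (n + 1))"
      unfolding fac using n by (simp add: divide_simps)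
    show ?thesis
      unfolding eq using n by (simp add: divide_simps) (simp add: algebra_simps power2_eq_square)
  qed
  also have "\<dots> \<le> - 1 / (2 * n)"
    using n by simp
  finally have "exp (ln (n / (n + 1) * (n / sqrt (n\<^sup>2 - 1)) ^ (m - 1))) \<le> exp (- 1 / (2 * n))"
    by (simp only: exp_le_cancel_iff)
  moreover have "n / (n + 1) * (n / sqrt (n\<^sup>2 - 1)) ^ (m - 1) > 0"
    using pos by (intro mult_pos_pos zero_less_power)
  ultimately show ?thesis
    by (simp only: exp_ln)
qed

section \<open>The smallest ellipsoid around a half ball\<close>

lemma inner_matrix_vector_mult:
  fixes A :: "real ^ 'n ^ 'm"
  shows "x \<bullet> (A *v y) = (transpose A *v x) \<bullet> y"
  by (simp add: dot_lmul_matrix)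

lemma outer_product_mult_vec: "outer_product w *v x = (w \<bullet> x) *\<^sub>R w"
  by (simp add: outer_product_def vec_eq_iff matrix_vector_mult_def matrix_matrix_mult_def
      columnvector_def rowvector_def inner_vec_def sum_distrib_left mult_ac)

text \<open>
  The ellipsoid of least volume around the half ball of all \<open>p\<close> with \<open>norm p \<le> 1\<close> and \<open>p $ k \<le> 0\<close> has
  the center \<open>- axis k 1 / (n + 1)\<close>, the semi-axis \<open>n / (n + 1)\<close> in direction \<open>k\<close>, and all other
  semi-axes equal to \<open>n / sqrt (n\<^sup>2 - 1)\<close>.
\<close>

definition half_ball_map :: "'n::finite \<Rightarrow> real ^ 'n ^ 'n" where
  "half_ball_map k = (let n = real CARD('n) in
     \<chi> i j. if i = j then (if i = k then n / (n + 1) else n / sqrt (n\<^sup>2 - 1)) else 0)"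

lemma half_ball_map_mult_vec:
  fixes k :: "'n::finite"
  defines "n \<equiv> real CARD('n)"
  shows "(half_ball_map k *v x) $ i = (if i = k then n / (n + 1) else n / sqrt (n\<^sup>2 - 1)) * x $ i"
proof -
  let ?M = "half_ball_map k"
  have "(?M *v x) $ i = ?M $ i $ i * x $ i + (\<Sum>j\<in>UNIV - {i}. ?M $ i $ j * x $ j)"
    by (simp add: matrix_vector_mult_def sum.remove[of UNIV i])
  also have "(\<Sum>j\<in>UNIV - {i}. ?M $ i $ j * x $ j) = 0"
    by (intro sum.neutral) (auto simp: half_ball_map_def Let_def)
  finally show ?thesis
    by (simp add: half_ball_map_def Let_def n_def)
qed

lemma transpose_half_ball_map: "transpose (half_ball_map k) = half_ball_map k"
  by (auto simp: half_ball_map_def transpose_def vec_eq_iff Let_def)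

lemma det_half_ball_map:
  fixes k :: "'n::finite"
  defines "n \<equiv> real CARD('n)"
  shows "det (half_ball_map k) = (n / (n + 1)) * (n / sqrt (n\<^sup>2 - 1)) ^ (CARD('n) - 1)"
proof -
  have "det (half_ball_map k)
      = (\<Prod>i\<in>UNIV. if i = k then n / (n + 1) else n / sqrt (n\<^sup>2 - 1))"
    by (subst det_diagonal) (auto simp: half_ball_map_def n_def Let_def cong: if_cong)
  also have "\<dots> = (n / (n + 1)) * (\<Prod>i\<in>UNIV - {k}. n / sqrt (n\<^sup>2 - 1))"
    by (subst prod.remove[of _ k]) (auto intro!: prod.cong)
  also have "\<dots> = (n / (n + 1)) * (n / sqrt (n\<^sup>2 - 1)) ^ (CARD('n) - 1)"
    by simp
  finally show ?thesis .
qed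

text \<open>
  The square is a multiple of a rank-one perturbation of the identity. This is where the
  coefficients of the matrix update of the method come from.
\<close>

lemma half_ball_map_squared:
  fixes k :: "'n::finite"
  defines "n \<equiv> real CARD('n)"
  assumes "CARD('n) \<ge> 2"
  shows "half_ball_map k *v (half_ball_map k *v x)
       = (n\<^sup>2 / (n\<^sup>2 - 1)) *\<^sub>R (x - (2 / (n + 1)) *\<^sub>R (x $ k *\<^sub>R axis k 1))"
proof -
  have n: "n \<ge> 2"
    using assms by (simp add: n_def)
  then have n2: "n\<^sup>2 > 1"
    by (smt (verit) one_less_power pos2)
  have fac: "n\<^sup>2 - 1 = (n - 1) * (n + 1)"
    by (simp add: power2_eq_square algebra_simps)
  let ?d = "\<lambda>i. if i = k then n / (n + 1) else n / sqrt (n\<^sup>2 - 1)"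
  have "?d k * ?d k = n\<^sup>2 / (n\<^sup>2 - 1) * (1 - 2 / (n + 1))"
    unfolding fac using n by (simp add: divide_simps power2_eq_square)
  then have k: "?d k * (?d k * y) = n\<^sup>2 / (n\<^sup>2 - 1) * (y - 2 / (n + 1) * y)" for y
    by algebra
  have "?d i * (?d i * x $ i)
      = n\<^sup>2 / (n\<^sup>2 - 1) * (x $ i - 2 / (n + 1) * (x $ k * (if i = k then 1 else 0)))" for i
  proof (cases "i = k")
    case True
    then show ?thesis
      using k[of "x $ k"] by simp
  next
    case False
    then show ?thesis
      using n2 by (simp add: power2_eq_square)
  qed
  then show ?thesis
    by (simp only: vec_eq_iff half_ball_map_mult_vec n_def[symmetric] vector_scaleR_component
        vector_minus_component axis_def vec_lambda_beta real_scaleR_def simp_thms)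
qed

text \<open>
  The preimage \<open>z\<close> can be written down, and \<open>z \<bullet> z\<close> is at most
  \<open>1 + 2 * (n + 1) / n\<^sup>2 * (p $ k * (p $ k + 1))\<close>. The last product is nonpositive since \<open>p $ k\<close> lies
  between -1 and 0.
\<close>

lemma half_ball_map_cover:
  fixes k :: "'n::finite"
  defines "n \<equiv> real CARD('n)"
  assumes "CARD('n) \<ge> 2" and p: "norm p \<le> 1" "p $ k \<le> 0"
  obtains z where "norm z \<le> 1" "half_ball_map k *v z = p + (1 / (n + 1)) *\<^sub>R axis k 1"
proof -
  have n: "n \<ge> 2"
    using assms by (simp add: n_def)
  then have n2: "n\<^sup>2 > 1"
    by (smt (verit) one_less_power pos2)
  define z where "z = (\<chi> i. if i = k then (p $ k + 1 / (n + 1)) * ((n + 1) / n)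
    else p $ i * (sqrt (n\<^sup>2 - 1) / n))"
  have pk: "p $ k \<ge> -1"
    using component_le_norm_cart[of p k] p by linarith
  have "p \<bullet> p \<le> 1"
    using p by (simp add: dot_square_norm abs_square_le_1)
  then have rest: "(\<Sum>i\<in>UNIV - {k}. (p $ i)\<^sup>2) \<le> 1 - (p $ k)\<^sup>2"
    by (simp add: inner_vec_def power2_eq_square sum.remove[of UNIV k])
  have "z \<bullet> z = (\<Sum>i\<in>UNIV. (z $ i)\<^sup>2)"
    by (simp add: inner_vec_def power2_eq_square)
  also have "\<dots> = (z $ k)\<^sup>2 + (\<Sum>i\<in>UNIV - {k}. (z $ i)\<^sup>2)"
    by (rule sum.remove) auto
  also have "(\<Sum>i\<in>UNIV - {k}. (z $ i)\<^sup>2) = (\<Sum>i\<in>UNIV - {k}. (n\<^sup>2 - 1) / n\<^sup>2 * (p $ i)\<^sup>2)"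
    using n2 by (intro sum.cong) (auto simp: z_def power_mult_distrib power_divide)
  also have "\<dots> = (n\<^sup>2 - 1) / n\<^sup>2 * (\<Sum>i\<in>UNIV - {k}. (p $ i)\<^sup>2)"
    by (simp add: sum_distrib_left)
  also have "\<dots> \<le> (n\<^sup>2 - 1) / n\<^sup>2 * (1 - (p $ k)\<^sup>2)"
    using rest n2 by (intro mult_left_mono) auto
  also have "(z $ k)\<^sup>2 + (n\<^sup>2 - 1) / n\<^sup>2 * (1 - (p $ k)\<^sup>2)
      = 1 + 2 * (n + 1) / n\<^sup>2 * (p $ k * (p $ k + 1))"
  proof -
    have zk: "z $ k = ((n + 1) * p $ k + 1) / n"
      using n by (simp add: z_def divide_simps)
    show ?thesis
      unfolding zk using n by (simp add: power_divide divide_simps)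
        (simp add: algebra_simps power2_eq_square)
  qed
  also have "\<dots> \<le> 1"
    using n pk p mult_nonneg_nonpos[of "2 * (n + 1) / n\<^sup>2" "p $ k * (p $ k + 1)"]
    by (simp add: mult_nonpos_nonneg)
  finally have "norm z \<le> 1"
    by (simp add: norm_le_square)
  moreover have "n\<^sup>2 \<noteq> 1"
    using n2 by simp
  then have "half_ball_map k *v z = p + (1 / (n + 1)) *\<^sub>R axis k 1"
    using n \<open>n\<^sup>2 \<noteq> 1\<close> by (auto simp: vec_eq_iff half_ball_map_mult_vec z_def axis_def simp flip: n_def)
  ultimately show thesis
    by (rule that)
qed

section \<open>One step of the method\<close>

text \<open>
  In the coordinates \<open>x = c + A *v y\<close> the ellipsoid is the unit ball, and the cut is the half space
  with outer normal \<open>v = transpose A *v w\<close>. A rotation \<open>Q\<close> that maps a coordinate vector to the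
  normalized \<open>v\<close> turns the cut ball into the standard half ball, so \<open>A ** Q ** half_ball_map k\<close> is
  a factor of the next matrix.
\<close>

lemma ellipsoid_step:
  fixes A :: "real ^ 'n ^ 'n"
  defines "n \<equiv> real CARD('n)"
  assumes n: "CARD('n) \<ge> 2" and A: "det A \<noteq> 0" and w: "w \<noteq> 0"
  obtains A' where
    "next_matrix (A ** transpose A) w = A' ** transpose A'"
    "\<bar>det A'\<bar> = (n / (n + 1)) * (n / sqrt (n\<^sup>2 - 1)) ^ (CARD('n) - 1) * \<bar>det A\<bar>"
    "\<And>x. x \<in> ellipsoid c A \<Longrightarrow> (x - c) \<bullet> w \<le> 0 \<Longrightarrow>
       x \<in> ellipsoid (next_center (A ** transpose A) w c) A'"
proof -
  define H where "H = A ** transpose A"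
  have H: "H *v x = A *v (transpose A *v x)" for x
    unfolding H_def by (simp only: matrix_vector_mul_assoc)
  define v where "v = transpose A *v w"
  have "v \<noteq> 0"
  proof
    assume "v = 0"
    obtain B where "A ** B = mat 1"
      using A by (auto simp: invertible_def simp flip: invertible_det_nz)
    then have "transpose B ** transpose A = mat 1"
      by (metis matrix_transpose_mul transpose_mat)
    then have "w = transpose B *v v"
      unfolding v_def by (simp only: matrix_vector_mul_assoc matrix_vector_mul_lid)
    with \<open>v = 0\<close> w show False by simp
  qed
  define u where "u = v /\<^sub>R norm v"
  have u: "norm u = 1"
    using \<open>v \<noteq> 0\<close> by (simp add: u_def)
  \<comment> \<open>The coordinate \<open>k\<close> is arbitrary; the rotation moves it to the direction of the cut.\<close>
  obtain k :: 'n where True by blast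
  obtain Q where Q: "orthogonal_matrix Q" "Q *v axis k 1 = u"
    using orthogonal_matrix_exists_basis[OF u] by metis
  then have QT: "Q ** transpose Q = mat 1"
    by (simp add: orthogonal_matrix_def)
  have QTQ: "Q *v (transpose Q *v x) = x" for x
    by (simp only: matrix_vector_mul_assoc QT matrix_vector_mul_lid)
  have QTk: "(transpose Q *v x) $ k = u \<bullet> x" for x
    using inner_matrix_vector_mult[of x Q "axis k 1"] Q(2)
    by (simp add: inner_axis inner_commute[of u x] del: transpose_matrix_vector)
  have QTnorm: "norm (transpose Q *v x) = norm x" for x
    using inner_matrix_vector_mult[of x Q "transpose Q *v x"]
    by (simp only: QTQ norm_eq_sqrt_inner)
  have wHw: "w \<bullet> (H *v w) = (norm v)\<^sup>2"
    unfolding H inner_matrix_vector_mult v_def[symmetric] by (simp add: dot_square_norm)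
  define A' where "A' = A ** Q ** half_ball_map k"
  have "next_matrix H w *v x = (A' ** transpose A') *v x" for x
  proof -
    define g where "g = transpose A *v x"
    have "(1 / (norm v)\<^sup>2) *\<^sub>R (H *v (outer_product w *v (H *v x)))
        = (1 / (norm v)\<^sup>2) *\<^sub>R ((v \<bullet> g) *\<^sub>R (A *v v))"
      unfolding outer_product_mult_vec matrix_vector_mult_scaleR
      by (simp only: H inner_matrix_vector_mult v_def g_def)
    also have "\<dots> = A *v ((u \<bullet> g) *\<^sub>R u)"
      using \<open>v \<noteq> 0\<close> by (simp add: u_def matrix_vector_mult_scaleR power2_eq_square divide_simps)
    finally have rank1: "(1 / (norm v)\<^sup>2) *\<^sub>R (H *v (outer_product w *v (H *v x)))
        = A *v ((u \<bullet> g) *\<^sub>R u)" .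
    have "next_matrix H w *v x = (n\<^sup>2 / (n\<^sup>2 - 1)) *\<^sub>R
        (H *v x - (2 / (n + 1)) *\<^sub>R
          ((1 / (norm v)\<^sup>2) *\<^sub>R (H *v (outer_product w *v (H *v x)))))"
      by (simp only: next_matrix_def w if_False wHw n_def matrix_vector_mult_diff_rdistrib
          flip: scaleR_matrix_vector_assoc matrix_vector_mul_assoc)
    also have "\<dots> = (n\<^sup>2 / (n\<^sup>2 - 1)) *\<^sub>R (A *v (g - (2 / (n + 1)) *\<^sub>R ((u \<bullet> g) *\<^sub>R u)))"
      unfolding rank1 unfolding H g_def
      by (simp only: matrix_vector_mult_diff_distrib matrix_vector_mult_scaleR)
    also have "\<dots> = A *v (Q *v (half_ball_map k *v (half_ball_map k *v (transpose Q *v g))))"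
      unfolding half_ball_map_squared[OF n] n_def[symmetric]
      by (simp only: matrix_vector_mult_diff_distrib matrix_vector_mult_scaleR QTQ QTk Q(2))
    also have "\<dots> = (A' ** transpose A') *v x"
      unfolding A'_def matrix_transpose_mul transpose_half_ball_map g_def
      by (simp only: matrix_vector_mul_assoc matrix_mul_assoc)
    finally show ?thesis .
  qed
  then have 1: "next_matrix H w = A' ** transpose A'"
    by (simp add: matrix_eq)
  have "n / sqrt (n\<^sup>2 - 1) \<ge> 0" "n \<ge> 0"
    using n by (auto simp: n_def)
  then have 2: "\<bar>det A'\<bar> = (n / (n + 1)) * (n / sqrt (n\<^sup>2 - 1)) ^ (CARD('n) - 1) * \<bar>det A\<bar>"
    using det_orthogonal_matrix[OF Q(1)]
    by (auto simp: A'_def det_mul det_half_ball_map abs_mult simp flip: n_def)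
  have 3: "x \<in> ellipsoid (next_center H w c) A'" if x: "x \<in> ellipsoid c A" "(x - c) \<bullet> w \<le> 0" for x
  proof -
    obtain y where y: "norm y \<le> 1" "x = c + A *v y"
      using x(1) by (auto simp: ellipsoid_def)
    have "v \<bullet> y \<le> 0"
      using x(2) inner_matrix_vector_mult[of w A y] by (simp add: y v_def inner_commute)
    then have "u \<bullet> y \<le> 0"
      by (simp add: u_def divide_simps)
    then obtain z where z: "norm z \<le> 1"
      "half_ball_map k *v z = transpose Q *v y + (1 / (n + 1)) *\<^sub>R axis k 1"
      using half_ball_map_cover[OF n, of "transpose Q *v y" k] y(1)
      unfolding QTnorm QTk n_def by metis
    have "A' *v z = A *v (Q *v (half_ball_map k *v z))"
      by (simp only: A'_def matrix_vector_mul_assoc matrix_mul_assoc)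
    also have "\<dots> = A *v y + (1 / (n + 1)) *\<^sub>R (A *v u)"
      by (simp only: z matrix_vector_right_distrib matrix_vector_mult_scaleR QTQ Q(2))
    moreover have "next_center H w c = c - (1 / (n + 1)) *\<^sub>R (A *v u)"
    proof -
      have "(1 / sqrt (w \<bullet> (H *v w))) *\<^sub>R (H *v w) = A *v u"
        unfolding wHw unfolding H v_def[symmetric]
        by (simp add: u_def matrix_vector_mult_scaleR inverse_eq_divide)
      then show ?thesis
        by (simp only: next_center_def w if_False n_def)
    qed
    ultimately have "x = next_center H w c + A' *v z"
      using y by simp
    with z(1) show ?thesis
      by (auto simp: ellipsoid_def)
  qed
  show thesis
    using that[of A'] 1 2 3 by (simp add: H_def)
qed

section \<open>Runs of the method\<close>

text \<open>
  Zero answers are excluded since they leave the ellipsoid unchanged, and the volume would not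
  shrink.
\<close>

lemma ellipsoid_run_invariant:
  fixes c w :: "nat \<Rightarrow> real ^ 'n"
  assumes n: "CARD('n) \<ge> 2" and "R > 0"
    and run: "ellipsoid_run X f c0 (R\<^sup>2 *\<^sub>R mat 1) c H w"
    and w: "\<And>s. s < T \<Longrightarrow> w s \<noteq> 0"
  obtains A where "H T = A ** transpose A" "det A \<noteq> 0"
    "\<bar>det A\<bar> \<le> R ^ CARD('n) * exp (- real T / (2 * real CARD('n)))"
    "\<And>x. x \<in> cball c0 R \<Longrightarrow> (\<And>s. s < T \<Longrightarrow> (x - c s) \<bullet> w s \<le> 0) \<Longrightarrow> x \<in> ellipsoid (c T) A"
  using w
proof (induction T arbitrary: thesis)
  case 0
  have "R *\<^sub>R mat 1 ** transpose (R *\<^sub>R mat 1 :: real ^ 'n ^ 'n) = R\<^sup>2 *\<^sub>R mat 1"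
    by (simp add: transpose_scalar transpose_mat matrix_scalar_ac power2_eq_square
        flip: scalar_matrix_assoc)
  moreover have "x \<in> ellipsoid c0 (R *\<^sub>R mat 1)" if "x \<in> cball c0 R" for x
  proof -
    have "x = c0 + (R *\<^sub>R mat 1) *v ((x - c0) /\<^sub>R R)"
      using \<open>R > 0\<close> by (simp flip: scaleR_matrix_vector_assoc)
    moreover have "norm ((x - c0) /\<^sub>R R) \<le> 1"
      using that \<open>R > 0\<close> by (simp add: dist_norm norm_minus_commute divide_simps)
    ultimately show ?thesis
      unfolding ellipsoid_def by (intro image_eqI) auto
  qed
  ultimately show ?case
    using run \<open>R > 0\<close> by (intro 0(1)[of "R *\<^sub>R mat 1"]) (auto simp: ellipsoid_run_def det_scaleR)
next
  case (Suc T)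
  obtain A where A: "H T = A ** transpose A" "det A \<noteq> 0"
    "\<bar>det A\<bar> \<le> R ^ CARD('n) * exp (- real T / (2 * real CARD('n)))"
    "\<And>x. x \<in> cball c0 R \<Longrightarrow> (\<And>s. s < T \<Longrightarrow> (x - c s) \<bullet> w s \<le> 0) \<Longrightarrow> x \<in> ellipsoid (c T) A"
    using Suc.IH Suc.prems(2) by (metis less_Suc_eq)
  define n where "n = real CARD('n)"
  define q where "q = (n / (n + 1)) * (n / sqrt (n\<^sup>2 - 1)) ^ (CARD('n) - 1)"
  have "n \<ge> 2"
    using n by (simp add: n_def)
  then have "n\<^sup>2 > 1"
    by (smt (verit) one_less_power pos2)
  with \<open>n \<ge> 2\<close> have "q > 0"
    by (simp add: q_def)
  obtain A' where A': "next_matrix (H T) (w T) = A' ** transpose A'" "\<bar>det A'\<bar> = q * \<bar>det A\<bar>"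
    "\<And>x. x \<in> ellipsoid (c T) A \<Longrightarrow> (x - c T) \<bullet> w T \<le> 0 \<Longrightarrow>
       x \<in> ellipsoid (next_center (H T) (w T) (c T)) A'"
    using ellipsoid_step[OF n A(2), of "w T" "c T"] Suc.prems(2)[of T]
    unfolding A(1) q_def n_def by blast
  have "q * \<bar>det A\<bar> \<le> exp (- 1 / (2 * n)) * (R ^ CARD('n) * exp (- real T / (2 * n)))"
    using shrink_factor_le[OF n] A(3) \<open>q > 0\<close>
    by (intro mult_mono) (auto simp: q_def n_def)
  also have "\<dots> = R ^ CARD('n) * exp (- real (Suc T) / (2 * n))"
    using \<open>n \<ge> 2\<close> by (simp add: field_simps flip: exp_add)
  finally have "\<bar>det A'\<bar> \<le> R ^ CARD('n) * exp (- real (Suc T) / (2 * real CARD('n)))"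
    by (simp only: A' n_def)
  moreover have "det A' \<noteq> 0"
    using A'(2) A(2) \<open>q > 0\<close> by auto
  ultimately show ?case
    using run A' A by (intro Suc.prems(1)[of A']) (auto simp: ellipsoid_run_def)
qed

text \<open>
  Either a zero answer marks a minimizer, or some point of the shrunken ball is cut off, and the
  center that cuts it off is feasible and at least as good as that point.
\<close>

lemma exists_good_center:
  fixes c w :: "nat \<Rightarrow> real ^ 'n"
  assumes n: "CARD('n) \<ge> 2" and "convex X" and f: "f \<in> X \<rightarrow> {-B..B}" "convex_on X f"
    and "r > 0" and "R \<ge> r"
    and XR: "X \<subseteq> cball c0 R" and zr: "cball z r \<subseteq> X"
    and run: "ellipsoid_run X f c0 (R\<^sup>2 *\<^sub>R mat 1) c H w"
    and t: "real t \<ge> 2 * (real CARD('n))\<^sup>2 * ln (R / r)"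
    and xs: "x' \<in> X" "\<And>y. y \<in> X \<Longrightarrow> f x' \<le> f y"
  obtains s where "s \<le> t" "c s \<in> X"
    "f (c s) - f x' \<le> 2 * B * R / r * exp (- real t / (2 * (real CARD('n))\<^sup>2))"
proof -
  define n where "n = real CARD('n)"
  have "n \<ge> 2"
    using n by (simp add: n_def)
  define \<epsilon> where "\<epsilon> = R / r * exp (- real t / (2 * n\<^sup>2))"
  have "\<epsilon> > 0"
    using \<open>r > 0\<close> \<open>R \<ge> r\<close> by (simp add: \<epsilon>_def)
  have "ln (R / r) \<le> real t / (2 * n\<^sup>2)"
    using t \<open>n \<ge> 2\<close> by (simp add: n_def field_simps)
  then have "R / r \<le> exp (real t / (2 * n\<^sup>2))"
    using \<open>r > 0\<close> \<open>R \<ge> r\<close> by (metis divide_pos_pos exp_le_cancel_iff exp_ln less_le_trans)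
  then have "\<epsilon> \<le> exp (real t / (2 * n\<^sup>2)) * exp (- real t / (2 * n\<^sup>2))"
    unfolding \<epsilon>_def by (intro mult_right_mono) auto
  then have "\<epsilon> \<le> 1"
    by (simp flip: exp_add)
  have answer: "oracle_answer X f (c s) (w s)" for s
    using run by (simp add: ellipsoid_run_def)
  have "\<exists>s\<le>t. \<exists>x\<in>X. c s \<in> X \<and> f (c s) \<le> f x \<and> f x - f x' \<le> \<epsilon> * (2 * B)"
  proof (cases "\<exists>s\<le>t. w s = 0")
    case True
    then obtain s where s: "s \<le> t" "w s = 0" by auto
    then have "c s \<in> X" "f (c s) \<le> f x'"
      using answer[of s] xs(1) by (auto simp: oracle_answer_def subdifferential_def split: if_splits)
    moreover have "B \<ge> 0"
      using f(1) xs(1) by (force simp: Pi_iff)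
    ultimately show ?thesis
      using s xs(1) \<open>\<epsilon> > 0\<close> by (intro exI[of _ s]) (auto intro!: bexI[of _ x'])
  next
    case False
    define z' where "z' = (1 - \<epsilon>) *\<^sub>R x' + \<epsilon> *\<^sub>R z"
    have shrunk: "x \<in> X \<and> f x - f x' \<le> \<epsilon> * (2 * B)" if "x \<in> cball z' (\<epsilon> * r)" for x
    proof -
      define y where "y = z + (x - z') /\<^sub>R \<epsilon>"
      have "x = (1 - \<epsilon>) *\<^sub>R x' + \<epsilon> *\<^sub>R y"
        using \<open>\<epsilon> > 0\<close> by (simp add: y_def z'_def algebra_simps)
      have "dist z y \<le> r"
        using that \<open>\<epsilon> > 0\<close> by (simp add: y_def dist_norm norm_minus_commute divide_simps mult.commute)
      then have "y \<in> X"
        using zr by auto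
      have "x \<in> X"
        unfolding \<open>x = _\<close> using \<open>convex X\<close> xs(1) \<open>y \<in> X\<close> \<open>\<epsilon> > 0\<close> \<open>\<epsilon> \<le> 1\<close>
        by (intro convexD) auto
      have "f x \<le> (1 - \<epsilon>) * f x' + \<epsilon> * f y"
        unfolding \<open>x = _\<close> using f(2) xs(1) \<open>y \<in> X\<close> \<open>\<epsilon> > 0\<close> \<open>\<epsilon> \<le> 1\<close>
        by (intro convex_onD) auto
      then have "f x - f x' \<le> \<epsilon> * (f y - f x')"
        by (simp add: algebra_simps)
      also have "f y \<le> B" "f x' \<ge> - B"
        using f(1) xs(1) \<open>y \<in> X\<close> by (auto simp: Pi_iff)
      then have "\<epsilon> * (f y - f x') \<le> \<epsilon> * (2 * B)"
        using \<open>\<epsilon> > 0\<close> by (intro mult_left_mono) auto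
      finally show ?thesis
        using \<open>x \<in> X\<close> by simp
    qed
    \<comment> \<open>If nothing were cut, the ball would lie in the ellipsoid after \<open>t + 1\<close> steps. For \<open>t\<close> steps
      the two volume bounds coincide; the query at \<open>c t\<close> makes the comparison strict.\<close>
    have "\<exists>x\<in>cball z' (\<epsilon> * r). \<exists>s\<le>t. (x - c s) \<bullet> w s > 0"
    proof (rule ccontr)
      assume uncut: "\<not> ?thesis"
      obtain A where A: "det A \<noteq> 0" "\<bar>det A\<bar> \<le> R ^ CARD('n) * exp (- real (Suc t) / (2 * n))"
        "\<And>x. x \<in> cball c0 R \<Longrightarrow> (\<And>s. s < Suc t \<Longrightarrow> (x - c s) \<bullet> w s \<le> 0) \<Longrightarrow>
           x \<in> ellipsoid (c (Suc t)) A"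
        using ellipsoid_run_invariant[OF n _ run, of "Suc t"] False \<open>r > 0\<close> \<open>R \<ge> r\<close>
        unfolding n_def by (smt (verit) less_Suc_eq_le)
      have "cball z' (\<epsilon> * r) \<subseteq> ellipsoid (c (Suc t)) A"
      proof
        fix x assume x: "x \<in> cball z' (\<epsilon> * r)"
        with shrunk XR have "x \<in> cball c0 R" by blast
        with x uncut show "x \<in> ellipsoid (c (Suc t)) A"
          by (intro A(3)) (auto simp: not_less less_Suc_eq_le)
      qed
      then have "(\<epsilon> * r) ^ CARD('n) \<le> \<bar>det A\<bar>"
        using \<open>\<epsilon> > 0\<close> \<open>r > 0\<close> A(1) by (intro ball_in_ellipsoid_imp_det_ge) auto
      moreover have "(\<epsilon> * r) ^ CARD('n) = R ^ CARD('n) * exp (- real t / (2 * n))"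
      proof -
        have "\<epsilon> * r = R * exp (- real t / (2 * n\<^sup>2))"
          using \<open>r > 0\<close> by (simp add: \<epsilon>_def)
        moreover have "n * (- real t / (2 * n\<^sup>2)) = - real t / (2 * n)"
          using \<open>n \<ge> 2\<close> by (simp add: power2_eq_square)
        ultimately show ?thesis
          by (simp only: power_mult_distrib n_def flip: exp_of_nat_mult)
      qed
      moreover have "exp (- real (Suc t) / (2 * n)) < exp (- real t / (2 * n))"
        using \<open>n \<ge> 2\<close> by (simp add: divide_simps)
      then have "R ^ CARD('n) * exp (- real (Suc t) / (2 * n))
          < R ^ CARD('n) * exp (- real t / (2 * n))"
        using \<open>r > 0\<close> \<open>R \<ge> r\<close> by (intro mult_strict_left_mono) auto
      ultimately show False
        using A(2) by linarith
    qed
    then obtain x s where x: "x \<in> cball z' (\<epsilon> * r)" and s: "s \<le> t" "(x - c s) \<bullet> w s > 0"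
      by blast
    have "c s \<in> X"
      using answer[of s] s(2) shrunk[OF x] by (auto simp: oracle_answer_def split: if_splits)
    moreover from this have "f (c s) - f x \<le> w s \<bullet> (c s - x)"
      using answer[of s] shrunk[OF x] by (auto simp: oracle_answer_def subdifferential_def)
    then have "f (c s) \<le> f x"
      using s(2) by (simp add: inner_diff_left inner_diff_right inner_commute)
    ultimately show ?thesis
      using s(1) shrunk[OF x] by blast
  qed
  then obtain s x where "s \<le> t" "c s \<in> X" "f (c s) \<le> f x" "f x - f x' \<le> \<epsilon> * (2 * B)"
    by blast
  moreover have "\<epsilon> * (2 * B) = 2 * B * R / r * exp (- real t / (2 * n\<^sup>2))"
    by (simp add: \<epsilon>_def)
  ultimately show thesis
    by (intro that[of s]) (auto simp: n_def)
qed

theorem theorem2p4: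
  fixes X :: "(real ^ 'n) set" and f :: "real ^ 'n \<Rightarrow> real"
    and B R r :: real and c0 :: "real ^ 'n"
    and c w :: "nat \<Rightarrow> real ^ 'n" and H :: "nat \<Rightarrow> real ^ 'n ^ 'n" and t :: nat
  assumes "CARD('n) \<ge> 2"
    and "convex_body X"
    and "f \<in> X \<rightarrow> {-B..B}" and "continuous_on X f" and "convex_on X f"
    and "r > 0" and "R \<ge> r"
    and "X \<subseteq> cball c0 R" and "\<exists>z. cball z r \<subseteq> X"
    and "ellipsoid_run X f c0 (R\<^sup>2 *\<^sub>R mat 1) c H w"
    and "real t \<ge> 2 * (real CARD('n))\<^sup>2 * ln (R / r)"
  shows "c ` {0..t} \<inter> X \<noteq> {} \<and>
    (\<forall>x. is_arg_min f (\<lambda>y. y \<in> c ` {0..t} \<inter> X) x \<longrightarrow>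
       f x - (INF y\<in>X. f y) \<le> 2 * B * R / r * exp (- real t / (2 * (real CARD('n))\<^sup>2)))"
proof -
  have X: "compact X" "convex X" "X \<noteq> {}"
    using \<open>convex_body X\<close> by (auto simp: convex_body_def)
  obtain x' where x': "x' \<in> X" "\<And>y. y \<in> X \<Longrightarrow> f x' \<le> f y"
    using continuous_attains_inf[OF X(1,3) \<open>continuous_on X f\<close>] by blast
  then have inf: "(INF y\<in>X. f y) = f x'"
    by (intro cInf_eq_minimum) auto
  obtain z where "cball z r \<subseteq> X"
    using assms(9) by blast
  then obtain s where s: "s \<le> t" "c s \<in> X"
    "f (c s) - f x' \<le> 2 * B * R / r * exp (- real t / (2 * (real CARD('n))\<^sup>2))"
    using exists_good_center[OF assms(1) X(2) assms(3,5-8) _ assms(10,11) x'] by blast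
  then have mem: "c s \<in> c ` {0..t} \<inter> X"
    by auto
  then have "f x \<le> f (c s)" if "is_arg_min f (\<lambda>y. y \<in> c ` {0..t} \<inter> X) x" for x
    using that by (auto simp: is_arg_min_def not_less)
  with mem s(3) show ?thesis
    unfolding inf by fastforce
qed

end
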